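(* Let $G$ be a cyclic group of order $n>1$. Then $\mathcal{P}^\ast(G)$ is Eulerian if and only if $n$ is a power of $2$.
   Context: For a group $G$, $\mathcal{P}^\ast(G)$ is the simple undirected graph with vertex set $G\setminus\{1\}$ in which two distinct vertices $x,y$ are adjacent if and only if $y=x^m$ or $x=y^m$ for some positive integer $m$. A connected graph is Eulerian if it contains an Eulerian circuit, i.e. a closed walk that traverses every edge exactly once and visits every vertex; a single vertex with no edges counts as Eulerian. *)

theory Defs
  imports "HOL-Algebra.Elementary_Groups"
begin

text \<open>Simple undirected graphs: a vertex set together with a set of two-element edges.\<close>

record 'a ugraph =
  vertices :: "'a set"
  edges :: "'a set set"

text \<open>A walk is given by its nonempty list of successive vertices, so \<open>[v]\<close> is the walk of
  length 0 at \<open>v\<close>.\<close>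

fun walk_edges :: "'a list \<Rightarrow> 'a set list" where
  "walk_edges (x # y # xs) = {x, y} # walk_edges (y # xs)"
| "walk_edges _ = []"

definition is_walk :: "'a ugraph \<Rightarrow> 'a list \<Rightarrow> bool" where
  "is_walk H xs \<longleftrightarrow> xs \<noteq> [] \<and> set xs \<subseteq> vertices H \<and> set (walk_edges xs) \<subseteq> edges H"

definition connected_graph :: "'a ugraph \<Rightarrow> bool" where
  "connected_graph H \<longleftrightarrow> vertices H \<noteq> {} \<and>
    (\<forall>u \<in> vertices H. \<forall>v \<in> vertices H. \<exists>xs. is_walk H xs \<and> hd xs = u \<and> last xs = v)"

definition eulerian_circuit :: "'a ugraph \<Rightarrow> 'a list \<Rightarrow> bool" where
  "eulerian_circuit H xs \<longleftrightarrow> is_walk H xs \<and> hd xs = last xs \<and> set xs = vertices H \<and>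
    distinct (walk_edges xs) \<and> set (walk_edges xs) = edges H"

definition eulerian :: "'a ugraph \<Rightarrow> bool" where
  "eulerian H \<longleftrightarrow> connected_graph H \<and> (\<exists>xs. eulerian_circuit H xs)"

definition proper_power_graph :: "('a, 'b) monoid_scheme \<Rightarrow> 'a ugraph" where
  "proper_power_graph G = \<lparr>
    vertices = carrier G - {\<one>\<^bsub>G\<^esub>},
    edges = {{x, y} | x y. x \<in> carrier G - {\<one>\<^bsub>G\<^esub>} \<and> y \<in> carrier G - {\<one>\<^bsub>G\<^esub>} \<and> x \<noteq> y \<and>
      (\<exists>m::nat. m > 0 \<and> (y = x [^]\<^bsub>G\<^esub> m \<or> x = y [^]\<^bsub>G\<^esub> m))}\<rparr>"

end

theory Submission
  imports Defs "HOL-Algebra.Multiplicative_Group" "HOL-Computational_Algebra.Primes"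
begin

text \<open>If \<open>n = 2\<^sup>k\<close>, the subgroups of \<open>G\<close> form a chain, so the graph is complete on the odd number
  \<open>n - 1\<close> of vertices; a complete graph of odd order has an Eulerian circuit, since two new vertices
  can be absorbed by a closed detour from an old one. Otherwise \<open>G\<close> has an element \<open>x \<noteq> 1\<close>
  of odd order. Inversion acts without fixed points on the closed neighbourhood of \<open>x\<close>, because a fixed
  point would be an element of order \<open>2\<close>, which is never adjacent to \<open>x\<close>. Hence the degree of
  \<open>x\<close> is odd, which rules out an Eulerian circuit.\<close>

section \<open>Fixed-point-free involutions and parity of degrees in Eulerian graphs\<close>

lemma even_card_fixpoint_free_involution:
  assumes "finite A" "f ` A \<subseteq> A" "\<And>a. a \<in> A \<Longrightarrow> f (f a) = a" "\<And>a. a \<in> A \<Longrightarrow> f a \<noteq> a"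
  shows "even (card A)"
  using assms
proof (induction "card A" arbitrary: A rule: less_induct)
  case less
  show ?case
  proof (cases "A = {}")
    case False
    then obtain a where a: "a \<in> A" by blast
    \<comment> \<open>The orbit of \<open>a\<close> has exactly two elements, and its complement is
      again invariant under \<open>f\<close>.\<close>
    let ?B = "A - {a, f a}"
    have fa: "f a \<in> A" "f a \<noteq> a"
      using a less.prems by auto
    have card: "card A = card ?B + 2"
      using a fa less.prems(1) card_mono[of A "{a, f a}"]
      by (subst card_Diff_subset) auto
    have "f b \<noteq> a \<and> f b \<noteq> f a" if "b \<in> ?B" for b
      using that less.prems(3) a fa by (metis DiffE insertCI)
    then have "f ` ?B \<subseteq> ?B"
      using less.prems(2) by auto
    then have "even (card ?B)"
      using less.hyps[of ?B] card less.prems by auto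
    then show ?thesis using card by simp
  qed simp
qed

text \<open>Repeating \<open>last xs\<close> in front of \<open>ys\<close> accounts for the edge
  that joins the two pieces.\<close>

lemma walk_edges_append:
  "xs \<noteq> [] \<Longrightarrow> walk_edges (xs @ ys) = walk_edges xs @ walk_edges (last xs # ys)"
  by (induction xs rule: walk_edges.induct) auto

text \<open>Each inner visit to \<open>v\<close> uses two edges of the walk, and each end at
  \<open>v\<close> uses one. Cardinality 2 excludes loops, which would be counted once instead of
  twice.\<close>

lemma even_incident_walk_edges:
  assumes "xs \<noteq> []" "\<forall>e \<in> set (walk_edges xs). card e = 2"
  shows "even (length (filter (\<lambda>e. v \<in> e) (walk_edges xs))) \<longleftrightarrow> (v = hd xs \<longleftrightarrow> v = last xs)"
  using assms by (induction xs rule: walk_edges.induct) (auto simp: card_insert_if)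

lemma eulerian_even_degree:
  assumes "eulerian H" "\<forall>e \<in> edges H. card e = 2"
  shows "even (card {e \<in> edges H. v \<in> e})"
proof -
  obtain xs where xs: "xs \<noteq> []" "hd xs = last xs" "distinct (walk_edges xs)"
      "set (walk_edges xs) = edges H"
    using assms(1) unfolding eulerian_def eulerian_circuit_def is_walk_def by blast
  \<comment> \<open>The circuit lists every edge exactly once, so the degree can be read off from
    the list.\<close>
  have "card {e \<in> edges H. v \<in> e} = length (filter (\<lambda>e. v \<in> e) (walk_edges xs))"
    using xs(3,4) by (metis distinct_card distinct_filter set_filter)
  then show ?thesis
    using even_incident_walk_edges[of xs v] xs assms(2) by simp
qed

section \<open>Eulerian circuits in complete graphs of odd order\<close>

definition complete_edges :: "'a set \<Rightarrow> 'a set set" where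
  "complete_edges V = {{x, y} | x y. x \<in> V \<and> y \<in> V \<and> x \<noteq> y}"

lemma complete_edges_insert:
  "a \<notin> V \<Longrightarrow> complete_edges (insert a V) = complete_edges V \<union> (\<lambda>v. {a, v}) ` V"
  unfolding complete_edges_def by (auto simp: insert_commute)

text \<open>For \<open>vs\<close> of even length: the trail from \<open>a\<close> to \<open>a\<close> that uses precisely the edges joining
  \<open>a\<close> or \<open>b\<close> to a vertex of \<open>vs\<close>.\<close>

fun zigzag :: "'a \<Rightarrow> 'a \<Rightarrow> 'a list \<Rightarrow> 'a list" where
  "zigzag a b (v # w # vs) = a # v # b # w # zigzag a b vs"
| "zigzag a b _ = [a]"

lemma zigzag_Cons: "\<exists>zs. zigzag a b vs = a # zs"
  by (cases "(a, b, vs)" rule: zigzag.cases) auto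

lemma last_zigzag [simp]: "last (zigzag a b vs) = a"
proof (induction a b vs rule: zigzag.induct)
  case (1 a b v w vs)
  then show ?case using zigzag_Cons[of a b vs] by auto
qed auto

text \<open>\<open>b\<close> is added on the left because the trail misses it when \<open>vs\<close>
  is empty.\<close>

lemma set_zigzag:
  "even (length vs) \<Longrightarrow> set (zigzag a b vs) \<union> {b} = insert a (insert b (set vs))"
  by (induction a b vs rule: zigzag.induct) auto

lemma walk_edges_Cons_zigzag:
  "walk_edges (w # zigzag a b vs) = {w, a} # walk_edges (zigzag a b vs)"
  using zigzag_Cons[of a b vs] by auto

lemma set_walk_edges_zigzag:
  "even (length vs) \<Longrightarrow>
    set (walk_edges (zigzag a b vs)) = (\<lambda>v. {a, v}) ` set vs \<union> (\<lambda>v. {b, v}) ` set vs"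
  by (induction a b vs rule: zigzag.induct)
    (auto simp: walk_edges_Cons_zigzag insert_commute)

lemma distinct_walk_edges_zigzag:
  assumes "even (length vs)" "distinct (a # b # vs)"
  shows "distinct (walk_edges (zigzag a b vs))"
  using assms
proof (induction a b vs rule: zigzag.induct)
  case (1 a b v w vs)
  then have dist: "distinct (walk_edges (zigzag a b vs))"
    by simp
  have ne: "distinct [a, b, v, w]"
    using 1(3) by auto
  \<comment> \<open>One round is the 4-cycle through \<open>a\<close>, \<open>v\<close>,
    \<open>b\<close>, \<open>w\<close>. Each of its edges meets \<open>v\<close> or
    \<open>w\<close>, which later rounds never visit.\<close>
  have "v \<notin> e \<and> w \<notin> e" if "e \<in> set (walk_edges (zigzag a b vs))" for e
    using that 1(2,3) by (auto simp: set_walk_edges_zigzag)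
  then have "{a, v} \<notin> set (walk_edges (zigzag a b vs))" "{v, b} \<notin> set (walk_edges (zigzag a b vs))"
    "{b, w} \<notin> set (walk_edges (zigzag a b vs))" "{w, a} \<notin> set (walk_edges (zigzag a b vs))"
    by blast+
  then show ?case
    using dist ne by (auto simp: walk_edges_Cons_zigzag doubleton_eq_iff)
qed auto

lemma complete_graph_closed_trail:
  assumes "distinct ws" "odd (length ws)"
  shows "\<exists>xs. xs \<noteq> [] \<and> set xs = set ws \<and> hd xs = last xs \<and> distinct (walk_edges xs) \<and>
    set (walk_edges xs) = complete_edges (set ws)"
  using assms
proof (induction "length ws" arbitrary: ws rule: less_induct)
  case less
  show ?case
  proof (cases "length ws = 1")
    case True
    then obtain v where "ws = [v]" by (cases ws) auto
    then show ?thesis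
      by (intro exI[of _ "[v]"]) (auto simp: complete_edges_def)
  next
    case False
    then obtain a b us where ws: "ws = a # b # us"
      using less.prems by (metis One_nat_def even_zero length_0_conv length_Cons list.exhaust)
    then obtain xs where xs: "xs \<noteq> []" "set xs = set us" "hd xs = last xs"
        "distinct (walk_edges xs)" "set (walk_edges xs) = complete_edges (set us)"
      using less.hyps[of us] less.prems by auto
    define u where "u = last xs"
    have u: "u \<in> set us" using xs unfolding u_def by (metis last_in_set)
    define vs where "vs = remove1 u us"
    have vs: "set us = insert u (set vs)" "distinct (a # b # u # vs)" "even (length vs)"
      using u less.prems ws by (auto simp: vs_def length_remove1)
    obtain zs where zs: "zigzag a b vs = a # zs" using zigzag_Cons by metis
    \<comment> \<open>The old closed trail is based at \<open>u\<close>. The detour goes from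
      \<open>u\<close> to \<open>a\<close>, zigzags through \<open>vs\<close> back to
      \<open>a\<close>, and returns via \<open>b\<close>. Setting \<open>u\<close> aside makes the
      number of remaining old vertices even, as the zigzag requires; the triangle \<open>u\<close>,
      \<open>a\<close>, \<open>b\<close> supplies the edges that the zigzag leaves out.\<close>
    let ?ys = "xs @ zigzag a b vs @ [b, u]"
    have we: "walk_edges ?ys =
        walk_edges xs @ {u, a} # walk_edges (zigzag a b vs) @ [{a, b}, {b, u}]"
      using walk_edges_append[OF xs(1), of "zigzag a b vs @ [b, u]"]
        walk_edges_append[of "zigzag a b vs" "[b, u]"] zs last_zigzag[of a b vs]
      by (simp add: u_def)
    \<comment> \<open>Every edge of the detour contains \<open>a\<close> or \<open>b\<close>, so it
      cannot coincide with an old edge.\<close>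
    have ab: "e \<subseteq> set us" if "e \<in> complete_edges (set us)" for e
      using that by (auto simp: complete_edges_def)
    have "set ?ys = set ws"
      using set_zigzag[OF vs(3), of a b] xs(2) vs(1) u ws by auto
    moreover have "hd ?ys = last ?ys"
      using xs by (simp add: u_def)
    moreover have "distinct (walk_edges ?ys)"
      using distinct_walk_edges_zigzag[of vs a b] vs xs(4,5) ab
      unfolding we
      by (auto simp: set_walk_edges_zigzag doubleton_eq_iff)
    moreover have "set (walk_edges ?ys) = complete_edges (set ws)"
    proof -
      have "complete_edges (set ws) = complete_edges (set us) \<union> (\<lambda>v. {b, v}) ` set us
          \<union> (\<lambda>v. {a, v}) ` insert b (set us)"
        using vs(1,2) ws complete_edges_insert[of b "set us"]
          complete_edges_insert[of a "insert b (set us)"] by simp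
      then show ?thesis
        unfolding we using vs xs(5) by (auto simp: set_walk_edges_zigzag insert_commute)
    qed
    ultimately show ?thesis using xs(1) by (intro exI[of _ ?ys]) auto
  qed
qed

lemma eulerian_complete_graph:
  assumes "finite (vertices H)" "odd (card (vertices H))" "edges H = complete_edges (vertices H)"
  shows "eulerian H"
proof -
  obtain ws where ws: "set ws = vertices H" "distinct ws"
    using finite_distinct_list[OF assms(1)] by blast
  then have "odd (length ws)" using assms(2) distinct_card by metis
  then have "\<exists>xs. eulerian_circuit H xs"
    using complete_graph_closed_trail[OF ws(2)] ws(1) assms(3)
    unfolding eulerian_circuit_def is_walk_def by auto
  moreover have "connected_graph H"
    unfolding connected_graph_def
  proof (intro conjI ballI)
    show "vertices H \<noteq> {}" using assms(2) by auto
    fix u v assume uv: "u \<in> vertices H" "v \<in> vertices H"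
    show "\<exists>xs. is_walk H xs \<and> hd xs = u \<and> last xs = v"
    proof (cases "u = v")
      case True
      then show ?thesis using uv by (intro exI[of _ "[u]"]) (simp add: is_walk_def)
    next
      case False
      then show ?thesis using uv assms(3)
        by (intro exI[of _ "[u, v]"]) (auto simp: is_walk_def complete_edges_def)
    qed
  qed
  ultimately show ?thesis unfolding eulerian_def by blast
qed

section \<open>Degrees and completeness in proper power graphs\<close>

context group
begin

text \<open>Adjacency speaks of positive exponents only, so inversion has to be expressed by a
  natural one. Positive order encodes finiteness.\<close>

lemma inv_eq_nat_pow:
  assumes "y \<in> carrier G" "order G > 0"
  shows "inv y = y [^] (order G - 1)"
proof (rule inv_equality)
  show "y [^] (order G - 1) \<otimes> y = \<one>"
    using assms pow_order_eq_1[of y] nat_pow_Suc[of y "order G - 1"] by simp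
qed (use assms in auto)

text \<open>The order of \<open>y\<close> divides both 2 and the odd number
  \<open>m\<close>.\<close>

lemma odd_pow_square_eq_one:
  fixes m :: nat
  assumes "y \<in> carrier G" "y [^] m = \<one>" "odd m" "y [^] (2::nat) = \<one>"
  shows "y = \<one>"
proof -
  obtain q where "m = 2 * q + 1" using assms(3) oddE by blast
  then have "y [^] m = (y [^] (2::nat)) [^] q \<otimes> y"
    using assms(1) by (simp add: nat_pow_pow)
  then show ?thesis using assms by simp
qed

lemma odd_card_power_graph_edges:
  fixes m :: nat
  assumes fin: "finite (carrier G)"
    and x: "x \<in> carrier G" "x \<noteq> \<one>" "x [^] m = \<one>" "odd m"
  shows "odd (card {e \<in> edges (proper_power_graph G). x \<in> e})"
proof -
  \<comment> \<open>\<open>C\<close> is the closed neighbourhood of \<open>x\<close>: the exponent 1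
    puts \<open>x\<close> itself into it, so the degree of \<open>x\<close> is
    \<open>card C - 1\<close>.\<close>
  define C where "C = {y \<in> carrier G - {\<one>}. \<exists>j::nat. j > 0 \<and> (y = x [^] j \<or> x = y [^] j)}"
  \<comment> \<open>The strict bound makes the exponent \<open>order G - 1\<close> positive.\<close>
  have pos: "order G > 1"
  proof -
    have "card {\<one>, x} \<le> order G"
      unfolding order_def using fin x by (intro card_mono) auto
    then show ?thesis using x by simp
  qed
  have finC: "finite C" using fin by (simp add: C_def)
  have "x \<in> C" using x unfolding C_def by (auto intro!: exI[of _ "1::nat"])
  have "inv y \<in> C" if "y \<in> C" for y
  proof -
    have y: "y \<in> carrier G" "y \<noteq> \<one>" using that by (auto simp: C_def)
    have inv: "inv y = y [^] (order G - 1)"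
      using inv_eq_nat_pow[of y] y pos by simp
    have inv': "y = inv y [^] (order G - 1)"
      using inv_eq_nat_pow[of "inv y"] y pos by simp
    obtain j :: nat where j: "j > 0" "y = x [^] j \<or> x = y [^] j"
      using \<open>y \<in> C\<close> unfolding C_def by blast
    have "inv y = x [^] (j * (order G - 1)) \<or> x = inv y [^] ((order G - 1) * j)"
    using j(2)
    proof
      assume "y = x [^] j"
      then show ?thesis using inv x(1) by (simp add: nat_pow_pow)
    next
      assume "x = y [^] j"
      then show ?thesis using arg_cong[OF inv', of "\<lambda>z. z [^] j"] y by (simp add: nat_pow_pow)
    qed
    moreover have "j * (order G - 1) > 0" "(order G - 1) * j > 0" using j pos by auto
    moreover have "inv y \<in> carrier G - {\<one>}" using y by simp
    ultimately show ?thesis unfolding C_def by blast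
  qed
  moreover have "inv y \<noteq> y" if "y \<in> C" for y
  proof
    assume "inv y = y"
    have y: "y \<in> carrier G" "y \<noteq> \<one>" using that by (auto simp: C_def)
    have sq: "y [^] (2::nat) = \<one>"
      using \<open>inv y = y\<close> y r_inv[of y] by (simp add: numeral_2_eq_2)
    obtain j :: nat where "y = x [^] j \<or> x = y [^] j"
      using \<open>y \<in> C\<close> unfolding C_def by blast
    \<comment> \<open>If \<open>y\<close> is a power of \<open>x\<close>, then \<open>y\<close>
      inherits the odd exponent \<open>m\<close>; if \<open>x\<close> is a power of
      \<open>y\<close>, then \<open>x\<close> inherits the exponent 2. Either way one of them is
      trivial.\<close>
    then show False
    proof
      assume "y = x [^] j"
      then have "y [^] m = (x [^] m) [^] j" using x(1) by (simp add: nat_pow_pow mult.commute)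
      then show False using odd_pow_square_eq_one[OF y(1) _ x(4) sq] x y by simp
    next
      assume "x = y [^] j"
      then have "x [^] (2::nat) = (y [^] (2::nat)) [^] j"
        using y(1) by (simp add: nat_pow_pow mult.commute)
      then show False using odd_pow_square_eq_one[OF x(1,3,4)] sq x by simp
    qed
  qed
  moreover have "inv (inv y) = y" if "y \<in> C" for y
    using that by (simp add: C_def)
  ultimately have "even (card C)"
    using finC by (intro even_card_fixpoint_free_involution[of C "\<lambda>y. inv y"]) auto
  moreover have "card C = Suc (card (C - {x}))"
    using finC \<open>x \<in> C\<close> by (simp only: card_Suc_Diff1)
  moreover have "{e \<in> edges (proper_power_graph G). x \<in> e} = (\<lambda>y. {x, y}) ` (C - {x})"
  proof (intro equalityI subsetI)
    fix e assume "e \<in> {e \<in> edges (proper_power_graph G). x \<in> e}"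
    then obtain u v where e: "e = {u, v}" "x \<in> e" "u \<noteq> v"
        "u \<in> carrier G - {\<one>}" "v \<in> carrier G - {\<one>}"
        "\<exists>j::nat. j > 0 \<and> (v = u [^] j \<or> u = v [^] j)"
      unfolding proper_power_graph_def by auto
    then consider "x = u" "v \<in> C - {x}" | "x = v" "u \<in> C - {x}"
      unfolding C_def by blast
    then show "e \<in> (\<lambda>y. {x, y}) ` (C - {x})"
      using e(1) by cases (auto simp: doubleton_eq_iff image_iff)
  next
    fix e assume "e \<in> (\<lambda>y. {x, y}) ` (C - {x})"
    then show "e \<in> {e \<in> edges (proper_power_graph G). x \<in> e}"
      using x unfolding C_def proper_power_graph_def by auto
  qed
  moreover have "inj_on (\<lambda>y. {x, y}) (C - {x})"
    by (auto simp: inj_on_def doubleton_eq_iff)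
  ultimately show ?thesis by (simp add: card_image)
qed

lemma not_eulerian_power_graph:
  fixes m :: nat
  assumes "finite (carrier G)" "x \<in> carrier G" "x \<noteq> \<one>" "x [^] m = \<one>" "odd m"
  shows "\<not> eulerian (proper_power_graph G)"
proof -
  have "\<forall>e \<in> edges (proper_power_graph G). card e = 2"
    unfolding proper_power_graph_def by auto
  then show ?thesis
    using odd_card_power_graph_edges[OF assms] eulerian_even_degree[of "proper_power_graph G" x]
    by auto
qed

text \<open>Up to generating the same subgroup, \<open>i\<close> may be replaced by its gcd with
  \<open>p ^ k\<close>. These gcds are powers of \<open>p\<close>, hence linearly ordered by
  divisibility.\<close>

lemma nat_pow_comparable_prime_power:
  fixes i j k p :: nat
  assumes g: "g \<in> carrier G" "g [^] (p ^ k) = \<one>" and p: "prime p"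
    and "i \<noteq> 0" "j \<noteq> 0"
  shows "\<exists>r::nat. g [^] j = (g [^] i) [^] r \<or> g [^] i = (g [^] j) [^] r"
proof -
  \<comment> \<open>Bezout over the naturals writes the gcd as a multiple of \<open>i\<close> up to
    a multiple of \<open>p ^ k\<close>, which \<open>g\<close> does not see. This form of the
    equation fails for \<open>i = 0\<close>.\<close>
  have *: "\<exists>r::nat. g [^] j = (g [^] i) [^] r" if ij: "i \<noteq> 0" "gcd i (p ^ k) dvd j" for i j :: nat
  proof -
    obtain r s where rs: "i * r = p ^ k * s + gcd i (p ^ k)"
      using bezout_nat[OF ij(1)] by blast
    obtain q where q: "j = gcd i (p ^ k) * q" using ij(2) by blast
    have "i * (r * q) = p ^ k * (s * q) + j"
      using arg_cong[OF rs, of "\<lambda>z. z * q"] q by (simp add: add_mult_distrib mult.assoc)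
    then have "(g [^] i) [^] (r * q) = (g [^] (p ^ k)) [^] (s * q) \<otimes> g [^] j"
      using g(1) by (simp add: nat_pow_pow nat_pow_mult)
    then have "g [^] j = (g [^] i) [^] (r * q)"
      using g by simp
    then show ?thesis by blast
  qed
  obtain a b where "gcd i (p ^ k) = p ^ a" "gcd j (p ^ k) = p ^ b"
    using divides_primepow_nat[OF p, of "gcd i (p ^ k)" k]
      divides_primepow_nat[OF p, of "gcd j (p ^ k)" k] by auto
  then have "gcd i (p ^ k) dvd gcd j (p ^ k) \<or> gcd j (p ^ k) dvd gcd i (p ^ k)"
    by (metis le_imp_power_dvd nat_le_linear)
  then have "gcd i (p ^ k) dvd j \<or> gcd j (p ^ k) dvd i"
    by (meson dvd_trans gcd_dvd1)
  then show ?thesis using *[of i j] *[of j i] assms(4,5) by blast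
qed

lemma power_graph_complete_prime_power:
  fixes k p :: nat
  assumes g: "g \<in> carrier G" "carrier G = range (\<lambda>i::nat. g [^] i)"
    and p: "prime p" "order G = p ^ k"
  shows "edges (proper_power_graph G) = complete_edges (vertices (proper_power_graph G))"
proof -
  have "\<exists>r::nat. r > 0 \<and> (y = x [^] r \<or> x = y [^] r)"
    if xy: "x \<in> carrier G - {\<one>}" "y \<in> carrier G - {\<one>}" for x y
  proof -
    obtain i j :: nat where ij: "x = g [^] i" "y = g [^] j" using xy g(2) by auto
    then have "i \<noteq> 0" "j \<noteq> 0" using xy by (auto intro: gr0I)
    then obtain r :: nat where r: "y = x [^] r \<or> x = y [^] r"
      using nat_pow_comparable_prime_power[OF g(1), where p = p and k = k and i = i and j = j] p pow_order_eq_1[OF g(1)] ij by auto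
    \<comment> \<open>The exponent 0 would make \<open>x\<close> or \<open>y\<close> the
      identity.\<close>
    then have "r > 0" using xy by (auto intro!: gr0I)
    then show ?thesis using r by blast
  qed
  then have "x \<in> carrier G - {\<one>} \<and> y \<in> carrier G - {\<one>} \<and> x \<noteq> y \<and>
      (\<exists>r::nat. r > 0 \<and> (y = x [^] r \<or> x = y [^] r)) \<longleftrightarrow>
      x \<in> carrier G - {\<one>} \<and> y \<in> carrier G - {\<one>} \<and> x \<noteq> y" for x y
    by meson
  then show ?thesis
    unfolding proper_power_graph_def complete_edges_def ugraph.select_convs by (simp only:)
qed

end

theorem proposition4:
  fixes G :: "'a monoid" and n :: nat
  assumes "group G"
    and "cyclic_group G"
    and "order G = n"
    and "n > 1"
  shows "eulerian (proper_power_graph G) \<longleftrightarrow> (\<exists>k::nat. n = 2 ^ k)"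
proof -
  interpret group G by fact
  have fin: "finite (carrier G)"
    using assms(3,4) order_gt_0_iff_finite by simp
  obtain g where g: "g \<in> carrier G" "carrier G = range (\<lambda>i::int. g [^]\<^bsub>G\<^esub> i)"
    using assms(2) cyclic_group by blast
  then have "generate G {g} = carrier G"
    by (auto simp: generate_pow)
  then have ord: "ord g = n" and gnat: "carrier G = range (\<lambda>i::nat. g [^]\<^bsub>G\<^esub> i)"
    using generate_pow_card[OF g(1)] generate_pow_on_finite_carrier[OF fin g(1)] assms(3)
    by (simp_all add: order_def full_SetCompr_eq)
  show ?thesis
  proof
    assume "\<exists>k::nat. n = 2 ^ k"
    then obtain k where k: "n = 2 ^ k" by blast
    then have "even n" using assms(4) by (cases k) auto
    moreover have "card (carrier G - {\<one>\<^bsub>G\<^esub>}) = n - 1"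
      using fin assms(3) by (simp add: order_def card_Diff_singleton)
    ultimately have "odd (card (vertices (proper_power_graph G)))"
      using assms(4) by (simp add: proper_power_graph_def)
    then show "eulerian (proper_power_graph G)"
      using power_graph_complete_prime_power[OF g(1) gnat two_is_prime_nat] k assms(3)
      by (intro eulerian_complete_graph) (auto intro: card_ge_0_finite odd_pos)
  next
    assume eul: "eulerian (proper_power_graph G)"
    have "n \<noteq> 0" "\<not> is_unit (2::nat)"
      using assms(4) by simp_all
    then obtain k m where km: "n = 2 ^ k * m" "odd m"
      by (rule multiplicity_decompose')
    have "m = 1"
    proof (rule ccontr)
      assume "m \<noteq> 1"
      \<comment> \<open>The 2-part of \<open>n\<close> is divided out: \<open>g\<close> raised to
        \<open>2 ^ k\<close> is a nontrivial element whose order divides the odd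
        \<open>m\<close>.\<close>
      then have "\<not> n dvd 2 ^ k" using km by (auto dest: dvd_imp_le)
      then have "g [^]\<^bsub>G\<^esub> (2 ^ k :: nat) \<noteq> \<one>\<^bsub>G\<^esub>"
        using pow_eq_id[OF g(1)] ord by metis
      moreover have "(g [^]\<^bsub>G\<^esub> (2 ^ k :: nat)) [^]\<^bsub>G\<^esub> m = \<one>\<^bsub>G\<^esub>"
        using g(1) km(1) assms(3) pow_order_eq_1[OF g(1)] by (simp add: nat_pow_pow)
      ultimately show False
        using not_eulerian_power_graph[OF fin, of "g [^]\<^bsub>G\<^esub> (2 ^ k :: nat)" m] km(2) g(1) eul by blast
    qed
    then show "\<exists>k::nat. n = 2 ^ k" using km by auto
  qed
qed

end
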